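(* Let $G$ be a linear algebraic group over $\mathbb{Q}$ and let $\Gamma$ be an arithmetic subgroup of $G$. Then there exists a subgroup of finite index $\Gamma'\subset\Gamma$ which is torsion free.
   Context: A subgroup $G\subset\mathrm{GL}_N(\mathbb{C})$ ($N\ge1$) is called linear algebraic over $\mathbb{Q}$ if it is the set of $g=(g_{ij})\in\mathrm{GL}_N(\mathbb{C})$ at which finitely many polynomials with coefficients in $\mathbb{Q}$ in the entries $g_{ij}$ and $\det(g)^{-1}$ vanish. Put $G(\mathbb{Q})=G\cap\mathrm{GL}_N(\mathbb{Q})$. Two subgroups $\Gamma_1,\Gamma_2$ of $G$ are commensurable if $\Gamma_1\cap\Gamma_2$ has finite index in both. An arithmetic subgroup of $G$ is a subgroup $\Gamma$ of $G(\mathbb{Q})$ which is commensurable with $G\cap\mathrm{GL}_N(\mathbb{Z})$. *)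

theory Defs
  imports "HOL-Analysis.Analysis" "HOL-Algebra.Coset" "HOL-Library.Poly_Mapping"
begin

definition GL :: "(complex^'n^'n) monoid" where
  "GL = \<lparr>carrier = {A. invertible A}, monoid.mult = (**), one = mat 1\<rparr>"

text \<open>For a subring \<open>R\<close> of the complex numbers, the group of units of the ring of matrices with
  entries in \<open>R\<close>: the inverse has to have entries in \<open>R\<close> as well (so for \<open>R = \<int>\<close> the determinant
  is a unit of \<open>\<int>\<close>).\<close>

definition GL_over :: "complex set \<Rightarrow> (complex^'n^'n) set" where
  "GL_over R = {A. (\<forall>i j. A $ i $ j \<in> R) \<and>
     (\<exists>B. (\<forall>i j. B $ i $ j \<in> R) \<and> A ** B = mat 1 \<and> B ** A = mat 1)}"

text \<open>Polynomials with rational coefficients in variables from \<open>'v\<close> are finitely supported maps from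
  monomials to coefficients, a monomial being a finitely supported map from variables to
  exponents.\<close>

type_synonym 'v rat_mpoly = "('v \<Rightarrow>\<^sub>0 nat) \<Rightarrow>\<^sub>0 rat"

definition eval_mpoly :: "('v \<Rightarrow> complex) \<Rightarrow> 'v rat_mpoly \<Rightarrow> complex" where
  "eval_mpoly x p = (\<Sum>m\<in>Poly_Mapping.keys p. of_rat (Poly_Mapping.lookup p m) *
     (\<Prod>v\<in>Poly_Mapping.keys m. x v ^ Poly_Mapping.lookup m v))"

datatype 'n gl_var = Entry 'n 'n | Det_Inv

fun gl_coord :: "complex^'n^'n \<Rightarrow> 'n gl_var \<Rightarrow> complex" where
  "gl_coord g (Entry i j) = g $ i $ j"
| "gl_coord g Det_Inv = inverse (det g)"

definition linear_algebraic_over_Q :: "(complex^'n^'n) set \<Rightarrow> bool" where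
  "linear_algebraic_over_Q G \<longleftrightarrow> subgroup G GL \<and>
     (\<exists>P :: 'n gl_var rat_mpoly set. finite P \<and>
        G = {g \<in> carrier GL. \<forall>p\<in>P. eval_mpoly (gl_coord g) p = 0})"

definition finite_index_subgroup :: "('a, 'b) monoid_scheme \<Rightarrow> 'a set \<Rightarrow> 'a set \<Rightarrow> bool" where
  "finite_index_subgroup G H K \<longleftrightarrow>
     subgroup H (G\<lparr>carrier := K\<rparr>) \<and> finite (rcosets\<^bsub>G\<lparr>carrier := K\<rparr>\<^esub> H)"

definition commensurable :: "('a, 'b) monoid_scheme \<Rightarrow> 'a set \<Rightarrow> 'a set \<Rightarrow> bool" where
  "commensurable G H K \<longleftrightarrow>
     finite_index_subgroup G (H \<inter> K) H \<and> finite_index_subgroup G (H \<inter> K) K"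

definition arithmetic_subgroup :: "(complex^'n^'n) set \<Rightarrow> (complex^'n^'n) set \<Rightarrow> bool" where
  "arithmetic_subgroup G \<Gamma> \<longleftrightarrow>
     subgroup \<Gamma> (GL\<lparr>carrier := G \<inter> GL_over \<rat>\<rparr>) \<and> commensurable GL \<Gamma> (G \<inter> GL_over \<int>)"

definition torsion_free :: "('a, 'b) monoid_scheme \<Rightarrow> 'a set \<Rightarrow> bool" where
  "torsion_free G H \<longleftrightarrow> (\<forall>x\<in>H. \<forall>n::nat. n > 0 \<and> x [^]\<^bsub>G\<^esub> n = \<one>\<^bsub>G\<^esub> \<longrightarrow> x = \<one>\<^bsub>G\<^esub>)"

end

theory Submission
  imports Defs
begin

text \<open>The group \<open>\<Gamma>'\<close> consists of the elements of \<open>\<Gamma> \<inter> GL(\<int>)\<close> congruent to \<open>1\<close> modulo \<open>3\<close>. It has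
  finite index, because there are only finitely many residues modulo \<open>3\<close>. It is torsion free by
  Minkowski's argument: let \<open>A\<^sup>n = 1\<close> and \<open>X = A - 1\<close> be divisible by \<open>m\<close>, where \<open>3\<close> divides \<open>m\<close>. If
  \<open>3\<close> does not divide \<open>n\<close>, then \<open>A\<^sup>n \<equiv> 1 + n X\<close> modulo \<open>m\<^sup>2\<close> shows that \<open>3m\<close> divides \<open>X\<close>. If
  \<open>n = 3\<close>, then \<open>3X + 3X\<^sup>2 + X\<^sup>3 = 0\<close> shows the same. Iterating, \<open>X\<close> is divisible by all powers of
  \<open>3\<close>, so \<open>X = 0\<close>; the case of general \<open>n\<close> follows by removing factors \<open>3\<close> from \<open>n\<close>.\<close>

section \<open>Integer matrices divisible by an integer\<close>

text \<open>This is the two-sided ideal m M_N(Z) of the ring of integer matrices, placed inside the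
  complex matrices so that it applies directly to elements of \<open>GL\<close>. The case m = 1 is
  M_N(Z) itself, and m = 0 leaves only the zero matrix.\<close>

definition int_multiples :: "int \<Rightarrow> (complex^'n^'n) set" where
  "int_multiples m = {X. \<forall>i j. \<exists>z. X $ i $ j = of_int (m * z)}"

lemma int_multiples_add:
  assumes "X \<in> int_multiples m" "Y \<in> int_multiples m"
  shows "X + Y \<in> int_multiples m"
proof -
  { fix i j
    obtain a b where "X $ i $ j = of_int (m * a)" "Y $ i $ j = of_int (m * b)"
      using assms unfolding int_multiples_def by blast
    then have "(X + Y) $ i $ j = of_int (m * (a + b))"
      by (simp add: algebra_simps)
    then have "\<exists>z. (X + Y) $ i $ j = of_int (m * z)" by blast }
  then show ?thesis by (simp add: int_multiples_def)
qed

lemma int_multiples_scale: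
  assumes "X \<in> int_multiples m"
  shows "real_of_int c *\<^sub>R X \<in> int_multiples (c * m)"
proof -
  { fix i j
    obtain a where "X $ i $ j = of_int (m * a)"
      using assms unfolding int_multiples_def by blast
    then have "(real_of_int c *\<^sub>R X) $ i $ j = of_int ((c * m) * a)"
      by (simp add: scaleR_conv_of_real[where 'a = complex])
    then have "\<exists>z. (real_of_int c *\<^sub>R X) $ i $ j = of_int ((c * m) * z)" by blast }
  then show ?thesis by (simp add: int_multiples_def)
qed

lemma int_multiples_dvd:
  assumes "X \<in> int_multiples m" "k dvd m"
  shows "X \<in> int_multiples k"
proof -
  { fix i j
    obtain a where a: "X $ i $ j = of_int (m * a)"
      using assms unfolding int_multiples_def by blast
    obtain d where "m = k * d" using assms(2) by (auto elim: dvdE)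
    with a have "X $ i $ j = of_int (k * (d * a))" by simp
    then have "\<exists>z. X $ i $ j = of_int (k * z)" by blast }
  then show ?thesis by (simp add: int_multiples_def)
qed

lemma int_multiples_minus:
  assumes "X \<in> int_multiples m" shows "- X \<in> int_multiples m"
  using int_multiples_dvd[OF int_multiples_scale[OF assms, of "-1"]] by simp

lemma int_multiples_diff:
  assumes "X \<in> int_multiples m" "Y \<in> int_multiples m"
  shows "X - Y \<in> int_multiples m"
  using int_multiples_add[OF assms(1) int_multiples_minus[OF assms(2)]] by simp

lemma int_multiples_mult:
  assumes "X \<in> int_multiples m" "Y \<in> int_multiples k"
  shows "X ** Y \<in> int_multiples (m * k)"
proof -
  obtain a where a: "\<And>i j. X $ i $ j = of_int (m * a i j)"
    using assms(1) unfolding int_multiples_def by (simp del: of_int_mult) metis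
  obtain b where b: "\<And>i j. Y $ i $ j = of_int (k * b i j)"
    using assms(2) unfolding int_multiples_def by (simp del: of_int_mult) metis
  have "(X ** Y) $ i $ j = of_int (m * k * (\<Sum>l\<in>UNIV. a i l * b l j))" for i j
    by (simp add: matrix_matrix_mult_def a b sum_distrib_left mult_ac)
  then show ?thesis unfolding int_multiples_def by blast
qed

lemma int_multiples_cancel:
  fixes X :: "complex^'n^'n"
  assumes "real_of_int c *\<^sub>R X \<in> int_multiples (c * m)" "c \<noteq> 0"
  shows "X \<in> int_multiples m"
proof -
  { fix i j
    obtain a where "(real_of_int c *\<^sub>R X) $ i $ j = of_int (c * m * a)"
      using assms(1) unfolding int_multiples_def by blast
    then have "of_int c * X $ i $ j = of_int c * (of_int (m * a) :: complex)"
      by (simp add: scaleR_conv_of_real[where 'a = complex])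
    then have "X $ i $ j = of_int (m * a)" using assms(2) by simp
    then have "\<exists>z. X $ i $ j = of_int (m * z)" by blast }
  then show ?thesis by (simp add: int_multiples_def)
qed

text \<open>Bezout: with u p + v c = 1, X = u (p X) + v (c X), and p m divides both summands. This
  is how a factor prime to 3 gets cancelled below.\<close>

lemma int_multiples_coprime:
  fixes X :: "complex^'n^'n"
  assumes X: "X \<in> int_multiples m" and cX: "real_of_int c *\<^sub>R X \<in> int_multiples (p * m)"
    and "coprime p c"
  shows "X \<in> int_multiples (p * m)"
proof -
  obtain u v where uv: "u * p + v * c = 1"
    using bezout_int[of p c] assms(3) by auto
  have "real_of_int v *\<^sub>R (real_of_int c *\<^sub>R X) \<in> int_multiples (p * m)"
    using int_multiples_dvd[OF int_multiples_scale[OF cX]] by simp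
  moreover have "real_of_int (u * p) *\<^sub>R X \<in> int_multiples (p * m)"
    using int_multiples_dvd[OF int_multiples_scale[OF X, of "u * p"], of "p * m"] by simp
  ultimately have "real_of_int (u * p + v * c) *\<^sub>R X \<in> int_multiples (p * m)"
    using int_multiples_add by (fastforce simp: scaleR_add_left)
  then show ?thesis by (simp only: uv of_int_1 scaleR_one)
qed

text \<open>A nonzero integer z satisfies |z| < 3^|z|, so it is not divisible by the power of 3 with
  exponent |z|. Applied to each entry.\<close>

lemma int_multiples_powers_eq_0:
  fixes X :: "complex^'n^'n"
  assumes "\<And>k. X \<in> int_multiples (3 ^ k)"
  shows "X = 0"
proof -
  have "X $ i $ j = 0" for i j
  proof -
    obtain z where z: "X $ i $ j = of_int z"
      using assms[of 0] unfolding int_multiples_def by auto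
    have dvd: "3 ^ k dvd z" for k
    proof -
      obtain w where "X $ i $ j = of_int (3 ^ k * w)"
        using assms[of k] unfolding int_multiples_def by blast
      with z show ?thesis by (metis dvd_triv_left of_int_eq_iff)
    qed
    have "z = 0"
    proof (rule ccontr)
      assume "z \<noteq> 0"
      then have "3 ^ nat \<bar>z\<bar> \<le> \<bar>z\<bar>"
        using dvd_imp_le_int[OF _ dvd[of "nat \<bar>z\<bar>"]] by simp
      moreover have "int (nat \<bar>z\<bar>) < 3 ^ nat \<bar>z\<bar>"
        using power_gt_expt[of 3 "nat \<bar>z\<bar>"] by (simp flip: of_nat_less_iff[where 'a = int])
      ultimately show False by simp
    qed
    with z show ?thesis by simp
  qed
  then show ?thesis by (simp add: vec_eq_iff)
qed

lemma int_multiples_1_iff: "X \<in> int_multiples 1 \<longleftrightarrow> (\<forall>i j. X $ i $ j \<in> \<int>)"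
  by (simp add: int_multiples_def Ints_def image_iff)

section \<open>The group \<open>GL\<close> and its subgroups \<open>GL_over R\<close>\<close>

lemma mult_GL: "A \<otimes>\<^bsub>GL\<^esub> B = A ** B"
  and one_GL: "\<one>\<^bsub>GL\<^esub> = mat 1"
  by (simp_all add: GL_def)

lemma group_GL: "group (GL :: (complex^'n^'n) monoid)"
proof (rule groupI)
  fix A :: "complex^'n^'n" assume "A \<in> carrier GL"
  then obtain B where "A ** B = mat 1" "B ** A = mat 1"
    by (auto simp: GL_def invertible_def)
  then show "\<exists>B\<in>carrier GL. B \<otimes>\<^bsub>GL\<^esub> A = \<one>\<^bsub>GL\<^esub>"
    by (auto simp: GL_def invertible_def)
next
  show "\<one>\<^bsub>GL\<^esub> \<in> carrier (GL :: (complex^'n^'n) monoid)"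
    by (auto simp: GL_def invertible_def intro!: exI[of _ "mat 1"])
qed (simp_all add: GL_def invertible_mult matrix_mul_assoc)

text \<open>Sums and products of entries stay in \<open>R\<close>, hence so do the entries of matrix
  products. Inverses stay inside because the condition in \<open>GL_over\<close> is symmetric in a
  matrix and its inverse.\<close>

lemma subgroup_GL_over:
  assumes "0 \<in> R" "1 \<in> R" "\<And>x y. x \<in> R \<Longrightarrow> y \<in> R \<Longrightarrow> x + y \<in> R"
    "\<And>x y. x \<in> R \<Longrightarrow> y \<in> R \<Longrightarrow> x * y \<in> R"
  shows "subgroup (GL_over R) (GL :: (complex^'n^'n) monoid)"
proof -
  interpret group "GL :: (complex^'n^'n) monoid" by (rule group_GL)
  have sum_R: "sum f S \<in> R" if "\<And>x. x \<in> S \<Longrightarrow> f x \<in> R" for f :: "'n \<Rightarrow> complex" and S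
    using that by (induction S rule: infinite_finite_induct) (auto intro: assms)
  have mult_R: "\<forall>i j. (A ** B) $ i $ j \<in> R"
    if "\<forall>i j. A $ i $ j \<in> R" "\<forall>i j. B $ i $ j \<in> R" for A B :: "complex^'n^'n"
    using that by (auto simp: matrix_matrix_mult_def intro!: sum_R assms(4))
  have one_R: "\<forall>i j. (mat 1 :: complex^'n^'n) $ i $ j \<in> R"
    using assms(1,2) by (simp add: mat_def)
  have carrier: "A \<in> carrier GL" if "A \<in> GL_over R" for A :: "complex^'n^'n"
    using that by (auto simp: GL_over_def GL_def invertible_def)
  show ?thesis
  proof (rule subgroupI)
    show "GL_over R \<subseteq> carrier (GL :: (complex^'n^'n) monoid)" using carrier by blast
    have "(mat 1 :: complex^'n^'n) \<in> GL_over R"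
      using one_R by (auto simp: GL_over_def intro!: exI[of _ "mat 1"])
    then show "GL_over R \<noteq> ({} :: (complex^'n^'n) set)" by blast
  next
    fix A :: "complex^'n^'n" assume A: "A \<in> GL_over R"
    then obtain B where B: "\<forall>i j. B $ i $ j \<in> R" "A ** B = mat 1" "B ** A = mat 1"
      by (auto simp: GL_over_def)
    have "B \<in> GL_over R" using A B by (auto simp: GL_over_def)
    moreover have "inv\<^bsub>GL\<^esub> A = B"
      using B(3) carrier[OF A] carrier[OF \<open>B \<in> GL_over R\<close>] by (intro inv_equality) (auto simp: mult_GL one_GL)
    ultimately show "inv\<^bsub>GL\<^esub> A \<in> GL_over R" by simp
  next
    fix A B :: "complex^'n^'n" assume "A \<in> GL_over R" "B \<in> GL_over R"
    then obtain A' B' where *: "\<forall>i j. A $ i $ j \<in> R" "\<forall>i j. B $ i $ j \<in> R"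
      "\<forall>i j. A' $ i $ j \<in> R" "A ** A' = mat 1" "A' ** A = mat 1"
      "\<forall>i j. B' $ i $ j \<in> R" "B ** B' = mat 1" "B' ** B = mat 1"
      by (auto simp: GL_over_def)
    have "(A ** B) ** (B' ** A') = mat 1" "(B' ** A') ** (A ** B) = mat 1"
      using * by (metis matrix_mul_assoc matrix_mul_rid)+
    with * mult_R show "A \<otimes>\<^bsub>GL\<^esub> B \<in> GL_over R"
      unfolding GL_over_def mult_GL by blast
  qed
qed

section \<open>Torsion of matrices congruent to 1 modulo 3\<close>

lemma matrix_add_rdistrib: "(A + B) ** C = A ** C + B ** (C :: 'a::semiring_1^'p^'n)"
  by (vector matrix_matrix_mult_def sum.distrib[symmetric] field_simps)

lemma matrix_diff_ldistrib: "A ** (B - C) = A ** B - A ** (C :: 'a::ring_1^'p^'n)"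
  by (vector matrix_matrix_mult_def sum_subtractf[symmetric] field_simps)

lemma matrix_diff_rdistrib: "(A - B) ** C = A ** C - B ** (C :: 'a::ring_1^'p^'n)"
  by (vector matrix_matrix_mult_def sum_subtractf[symmetric] field_simps)

text \<open>First-order expansion of (1 + X)^n for X = A - 1. With P = A^n, the induction rests on P
  A - 1 - (n + 1) X = (P - 1 - n X) + (P - 1) X, where \<open>m\<close> divides both P - 1 and
  X.\<close>

lemma GL_pow_congruence:
  fixes A :: "complex^'n^'n"
  assumes A: "A - mat 1 \<in> int_multiples m"
  shows "A [^]\<^bsub>GL\<^esub> n - mat 1 - real n *\<^sub>R (A - mat 1) \<in> int_multiples (m * m)"
proof (induction n)
  case 0
  show ?case by (simp add: one_GL int_multiples_def exI[of _ 0])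
next
  case (Suc n)
  let ?X = "A - mat 1" and ?P = "A [^]\<^bsub>GL\<^esub> n"
  \<comment> \<open>Adding n X back to the remainder shows that \<open>m\<close> divides A^n -
    1.\<close>
  have "?P - mat 1 - real n *\<^sub>R ?X + real n *\<^sub>R ?X \<in> int_multiples m"
    using int_multiples_dvd[OF Suc.IH, of m] int_multiples_dvd[OF int_multiples_scale[OF A, of "int n"], of m]
    by (intro int_multiples_add) auto
  then have "(?P - mat 1) ** ?X \<in> int_multiples (m * m)"
    using A by (intro int_multiples_mult) auto
  with Suc.IH have "(?P - mat 1 - real n *\<^sub>R ?X) + (?P - mat 1) ** ?X \<in> int_multiples (m * m)"
    by (rule int_multiples_add)
  moreover have "(?P - mat 1) ** ?X = ?P ** A - ?P - A + mat 1"
    by (simp add: matrix_diff_ldistrib matrix_diff_rdistrib)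
  ultimately show ?case
    by (simp add: mult_GL algebra_simps)
qed

lemma eq_one_if_congruence_mod_3_improves:
  fixes A :: "complex^'n^'n"
  assumes A: "A - mat 1 \<in> int_multiples 3"
    and step: "\<And>m. 3 dvd m \<Longrightarrow> m \<noteq> 0 \<Longrightarrow> A - mat 1 \<in> int_multiples m \<Longrightarrow> A - mat 1 \<in> int_multiples (3 * m)"
  shows "A = mat 1"
proof -
  \<comment> \<open>Starting from exponent 1 keeps the modulus divisible by 3, as
    \<open>step\<close> demands.\<close>
  have "A - mat 1 \<in> int_multiples (3 ^ Suc k)" for k
  proof (induction k)
    case (Suc k)
    show ?case using step[OF _ _ Suc] by simp
  qed (use A in simp)
  then have "A - mat 1 \<in> int_multiples (3 ^ k)" for k
    using int_multiples_dvd[of "A - mat 1" "3 ^ Suc k" "3 ^ k"] by simp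
  then show ?thesis using int_multiples_powers_eq_0 by fastforce
qed

lemma GL_torsion_coprime_3:
  fixes A :: "complex^'n^'n" and n :: nat
  assumes A: "A - mat 1 \<in> int_multiples 3" and n: "A [^]\<^bsub>GL\<^esub> n = mat 1" "\<not> 3 dvd n"
  shows "A = mat 1"
proof (rule eq_one_if_congruence_mod_3_improves[OF A])
  fix m :: int assume m: "3 dvd m" "m \<noteq> 0" and X: "A - mat 1 \<in> int_multiples m"
  \<comment> \<open>Since A^n = 1, the remainder in the expansion is just -n X.\<close>
  have "real n *\<^sub>R (A - mat 1) \<in> int_multiples (m * m)"
    using int_multiples_minus[OF GL_pow_congruence[OF X, of n]] n(1) by simp
  \<comment> \<open>As 3 divides \<open>m\<close>, 3 m divides m^2.\<close>
  then have "real_of_int (int n) *\<^sub>R (A - mat 1) \<in> int_multiples (3 * m)"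
    using int_multiples_dvd[of _ "m * m" "3 * m"] m by (simp add: mult_dvd_mono)
  moreover have "coprime 3 (int n)"
  proof -
    have "\<not> (3::int) dvd int n" using n(2) int_dvd_int_iff[of 3 n] by simp
    then show ?thesis by (intro prime_imp_coprime) simp_all
  qed
  ultimately show "A - mat 1 \<in> int_multiples (3 * m)"
    by (rule int_multiples_coprime[OF X])
qed

lemma scaleR_3: "3 *\<^sub>R x = x + x + (x :: 'a::real_vector)"
  using scaleR_add_left[of 2 1 x] by (simp add: scaleR_2)

text \<open>The first-order congruence only gives 3 X divisible by m^2, which is no gain when m = 3;
  so the cube is expanded in full. The coefficient 3 of X^2 supplies the missing factor. For the
  prime 2 the analogue fails: -1 has order 2 and is congruent to 1 modulo 2.\<close>

lemma GL_torsion_3: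
  fixes A :: "complex^'n^'n"
  assumes A: "A - mat 1 \<in> int_multiples 3" and "A [^]\<^bsub>GL\<^esub> (3::nat) = mat 1"
  shows "A = mat 1"
proof (rule eq_one_if_congruence_mod_3_improves[OF A])
  fix m :: int assume m: "3 dvd m" "m \<noteq> 0" and cong: "A - mat 1 \<in> int_multiples m"
  define X where "X = A - mat 1"
  have "mat 1 = A ** A ** A"
    using assms(2) by (simp add: numeral_3_eq_3 mult_GL one_GL)
  also have "A = X + mat 1" by (simp add: X_def)
  also have "(X + mat 1) ** (X + mat 1) ** (X + mat 1)
      = mat 1 + (3 *\<^sub>R X + 3 *\<^sub>R (X ** X) + X ** X ** X)"
    by (simp only: matrix_add_ldistrib matrix_add_rdistrib matrix_mul_lid matrix_mul_rid scaleR_3 add_ac)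
  finally have "3 *\<^sub>R X + 3 *\<^sub>R (X ** X) + X ** X ** X = 0"
    by (metis add_cancel_right_right)
  then have eq: "3 *\<^sub>R X = - (3 *\<^sub>R (X ** X) + X ** X ** X)"
    by (simp only: eq_neg_iff_add_eq_0 add.assoc)
  have XX: "X ** X \<in> int_multiples (m * m)"
    using cong by (simp add: int_multiples_mult X_def)
  \<comment> \<open>With m = 3 d one has 3 m^2 = 9 m d and m^3 = 9 m d^2, so 9 m divides both terms
    on the right of \<open>eq\<close>.\<close>
  obtain d where d: "m = 3 * d" using m by (auto elim: dvdE)
  have "3 *\<^sub>R (X ** X) \<in> int_multiples (3 * (3 * m))"
    using int_multiples_dvd[OF int_multiples_scale[OF XX, of 3], of "3 * (3 * m)"] d by simp
  moreover have "X ** X ** X \<in> int_multiples (3 * (3 * m))"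
    using int_multiples_dvd[OF int_multiples_mult[OF XX], of X m "3 * (3 * m)"] cong d
    by (simp add: X_def)
  ultimately have "3 *\<^sub>R X \<in> int_multiples (3 * (3 * m))"
    unfolding eq by (intro int_multiples_minus int_multiples_add)
  then show "A - mat 1 \<in> int_multiples (3 * m)"
    using int_multiples_cancel[of 3 X "3 * m"] by (simp add: X_def)
qed

text \<open>Strong induction on the exponent: if n = 3 k, then A^k is again congruent to 1 modulo 3
  and has cube 1, so A^k = 1 with the smaller positive exponent k.\<close>

lemma GL_torsion_mod_3:
  fixes A :: "complex^'n^'n" and n :: nat
  assumes "A \<in> carrier GL" "A - mat 1 \<in> int_multiples 3" "n > 0" "A [^]\<^bsub>GL\<^esub> n = mat 1"
  shows "A = mat 1"
  using assms(3,4)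
proof (induction n rule: less_induct)
  case (less n)
  interpret group "GL :: (complex^'n^'n) monoid" by (rule group_GL)
  show ?case
  proof (cases "3 dvd n")
    case False
    with less.prems assms(2) show ?thesis using GL_torsion_coprime_3 by blast
  next
    case True
    then obtain k where k: "n = k * 3" by (metis dvdE mult.commute)
    have "A [^]\<^bsub>GL\<^esub> k - mat 1 - real k *\<^sub>R (A - mat 1) + real k *\<^sub>R (A - mat 1) \<in> int_multiples 3"
      using int_multiples_dvd[OF GL_pow_congruence[OF assms(2), of k], of 3]
        int_multiples_dvd[OF int_multiples_scale[OF assms(2), of "int k"], of 3]
      by (intro int_multiples_add) auto
    then have "A [^]\<^bsub>GL\<^esub> k - mat 1 \<in> int_multiples 3" by simp
    moreover have "(A [^]\<^bsub>GL\<^esub> k) [^]\<^bsub>GL\<^esub> (3::nat) = mat 1"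
      using less.prems(2) k assms(1) nat_pow_pow by simp
    ultimately have "A [^]\<^bsub>GL\<^esub> k = mat 1" by (rule GL_torsion_3)
    with less.IH[of k] less.prems(1) k show ?thesis by simp
  qed
qed

section \<open>Subgroups of finite index\<close>

text \<open>Each fibre of \<open>f\<close> on \<open>H\<close> lies in a single right coset of
  \<open>K\<close>, so there are at most as many cosets as values of \<open>f\<close>.\<close>

lemma (in group) finite_index_subgroupI:
  assumes H: "subgroup H G" and K: "subgroup K G" "K \<subseteq> H"
    and F: "finite (f ` H)" "\<And>x y. x \<in> H \<Longrightarrow> y \<in> H \<Longrightarrow> f x = f y \<Longrightarrow> x \<otimes> inv y \<in> K"
  shows "finite_index_subgroup G K H"
proof -
  \<comment> \<open>\<open>?g\<close> maps a value of \<open>f\<close> to the coset of some element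
    of \<open>H\<close> attaining it.\<close>
  let ?g = "\<lambda>c. K #> (SOME y. y \<in> H \<and> f y = c)"
  have "K #> x \<in> ?g ` (f ` H)" if x: "x \<in> H" for x
  proof -
    define y where "y = (SOME y. y \<in> H \<and> f y = f x)"
    have y: "y \<in> H" "f y = f x"
      using someI[of "\<lambda>y. y \<in> H \<and> f y = f x" x] x by (auto simp: y_def)
    have c: "x \<in> carrier G" "y \<in> carrier G" using x y subgroup.subset[OF H] by auto
    have "x = (x \<otimes> inv y) \<otimes> y" using c by (simp add: m_assoc)
    then have "x \<in> K #> y" using F(2)[OF x y(1)] y by (force simp: r_coset_def)
    then have "K #> x = K #> y" using repr_independence[OF _ c(2) K(1)] by simp
    then show ?thesis using x by (auto simp: y_def)
  qed
  then have "rcosets\<^bsub>G\<lparr>carrier := H\<rparr>\<^esub> K \<subseteq> ?g ` (f ` H)"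
    by (auto simp: RCOSETS_def r_coset_def)
  then have "finite (rcosets\<^bsub>G\<lparr>carrier := H\<rparr>\<^esub> K)"
    using F(1) finite_subset by blast
  then show ?thesis
    using subgroup_incl[OF K(1) H K(2)] by (simp add: finite_index_subgroup_def)
qed

text \<open>Write x = k r(x) with r(x) a chosen element of the coset \<open>K #> x\<close> and k in
  \<open>K\<close>. The coset of x modulo \<open>K\<close> fixes r(x), and together with the coset
  of k modulo \<open>L\<close> it fixes \<open>L #> x\<close>. So \<open>f\<close>, the pair of
  these two cosets, serves in the criterion above.\<close>

lemma (in group) finite_index_subgroup_trans:
  assumes H: "subgroup H G" and KH: "finite_index_subgroup G K H" and LK: "finite_index_subgroup G L K"
  shows "finite_index_subgroup G L H"
proof -
  have K: "subgroup K G"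
    using KH H incl_subgroup by (auto simp: finite_index_subgroup_def)
  have L: "subgroup L G"
    using LK K incl_subgroup by (auto simp: finite_index_subgroup_def)
  have sub: "K \<subseteq> H" "L \<subseteq> K"
    using KH LK subgroup.subset by (fastforce simp: finite_index_subgroup_def)+
  define r where "r x = (SOME y. y \<in> K #> x)" for x
  have r: "r x \<in> K #> x" if "x \<in> H" for x
  proof -
    have "x \<in> K #> x" using rcos_self[OF _ K, of x] that subgroup.subset[OF H] by blast
    then show ?thesis unfolding r_def by (rule someI)
  qed
  \<comment> \<open>The choice is made from the coset as a set, so it is the same for all x in that
    coset.\<close>
  have r_eq: "r x = r y" if "K #> x = K #> y" for x y
    using that by (simp add: r_def)
  have c: "x \<in> carrier G" "r x \<in> carrier G" "x \<otimes> inv (r x) \<in> K" if x: "x \<in> H" for x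
  proof -
    show x': "x \<in> carrier G" using x subgroup.subset[OF H] by blast
    obtain k where k: "k \<in> K" "r x = k \<otimes> x" using r[OF x] by (auto simp: r_coset_def)
    have k': "k \<in> carrier G" using k subgroup.subset[OF K] by blast
    show "r x \<in> carrier G" using k k' x' by simp
    have "x \<otimes> inv (r x) = inv k" using k k' x' by (simp add: inv_mult_group m_assoc[symmetric])
    then show "x \<otimes> inv (r x) \<in> K" using k subgroup.m_inv_closed[OF K] by simp
  qed
  define f where "f x = (K #> x, L #> (x \<otimes> inv (r x)))" for x
  show ?thesis
  proof (rule finite_index_subgroupI[OF H L, where f = f])
    show "L \<subseteq> H" using sub by blast
    have "f ` H \<subseteq> (rcosets\<^bsub>G\<lparr>carrier := H\<rparr>\<^esub> K) \<times> (rcosets\<^bsub>G\<lparr>carrier := K\<rparr>\<^esub> L)"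
      using c by (auto simp: f_def RCOSETS_def r_coset_def)
    then show "finite (f ` H)"
      using KH LK by (simp add: finite_index_subgroup_def finite_subset)
  next
    fix x y assume x: "x \<in> H" and y: "y \<in> H" and "f x = f y"
    then have rxy: "r x = r y" and eq: "L #> (x \<otimes> inv (r x)) = L #> (y \<otimes> inv (r x))"
      using r_eq[of x y] by (auto simp: f_def)
    have "x \<otimes> inv (r x) \<in> L #> (y \<otimes> inv (r x))"
      using rcos_self[OF _ L] c[OF x] by (simp flip: eq)
    then obtain l where l: "l \<in> L" "x \<otimes> inv (r x) = l \<otimes> (y \<otimes> inv (r x))"
      by (auto simp: r_coset_def)
    have lc: "l \<in> carrier G" using l subgroup.subset[OF L] by blast
    \<comment> \<open>The common representative r(x) = r(y) cancels on the right.\<close>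
    have "x = l \<otimes> y"
      using l(2) lc c[OF x] c[OF y] by (simp add: m_assoc[symmetric])
    then show "x \<otimes> inv y \<in> L"
      using l lc c[OF y] by (simp add: m_assoc)
  qed
qed

section \<open>The congruence subgroup modulo 3\<close>

text \<open>On integral entries, \<lfloor>Re z\<rfloor> is the entry itself; the floor extends
  reduction modulo 3 to all complex matrices. All values lie in the finite set of square arrays over
  {0, 1, 2}.\<close>

lemma finite_residues_mod_3:
  fixes H :: "(complex^'n^'n) set"
  shows "finite ((\<lambda>A i j. \<lfloor>Re (A $ i $ j)\<rfloor> mod 3) ` H)"
proof -
  have *: "finite {f :: 'n \<Rightarrow> 'b. \<forall>i. f i \<in> B}" if "finite B" for B :: "'b set"
    using finite_set_of_finite_funs[of "UNIV :: 'n set" B] that by simp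
  have "finite {f :: 'n \<Rightarrow> 'n \<Rightarrow> int. \<forall>i. f i \<in> {g. \<forall>j. g j \<in> {0..<3}}}"
    by (intro *) simp
  then show ?thesis by (rule finite_subset[rotated]) auto
qed

text \<open>The subgroup is the kernel of reduction modulo 3 on \<open>H\<close>, so matrices with
  equal residues lie in one coset. Concretely, A B^-1 - 1 = (A - B) B^-1, and B^-1 is integral
  because it lies in \<open>H\<close>.\<close>

lemma mod_3_subgroup_finite_index:
  fixes H :: "(complex^'n^'n) set"
  assumes H: "subgroup H GL" and int: "H \<subseteq> int_multiples 1"
  shows "finite_index_subgroup GL {A \<in> H. A - mat 1 \<in> int_multiples 3} H"
proof -
  interpret group "GL :: (complex^'n^'n) monoid" by (rule group_GL)
  let ?K = "{A \<in> H. A - mat 1 \<in> int_multiples 3}"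
  note sub = subgroup.subset[OF H]
  have inv: "A ** inv\<^bsub>GL\<^esub> A = mat 1" "inv\<^bsub>GL\<^esub> A ** A = mat 1" "inv\<^bsub>GL\<^esub> A \<in> H"
    "inv\<^bsub>GL\<^esub> A \<in> int_multiples 1" if "A \<in> H" for A
    using that r_inv[of A] l_inv[of A] sub int subgroup.m_inv_closed[OF H that]
    by (auto simp: mult_GL one_GL)
  have diff_in: "A ** inv\<^bsub>GL\<^esub> B - mat 1 \<in> int_multiples 3"
    if "A \<in> H" "B \<in> H" "A - B \<in> int_multiples 3" for A B
  proof -
    have "A ** inv\<^bsub>GL\<^esub> B - mat 1 = (A - B) ** inv\<^bsub>GL\<^esub> B"
      by (simp add: matrix_diff_rdistrib inv that)
    then show ?thesis using int_multiples_mult[OF that(3) inv(4)[OF that(2)]] by simp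
  qed
  have one: "mat 1 \<in> H" using subgroup.one_closed[OF H] by (simp add: one_GL)
  have K: "subgroup ?K GL"
  proof (rule subgroupI)
    show "?K \<subseteq> carrier GL" using sub by blast
    have "mat 1 \<in> ?K" using one by (simp add: int_multiples_def exI[of _ 0])
    then show "?K \<noteq> {}" by blast
  next
    fix A assume A: "A \<in> ?K"
    \<comment> \<open>Closure under inverses is \<open>diff_in\<close> for the pair 1, A.\<close>
    then have "mat 1 - A \<in> int_multiples 3" using int_multiples_minus by fastforce
    then show "inv\<^bsub>GL\<^esub> A \<in> ?K" using diff_in[OF one, of A] A inv by simp
  next
    fix A B assume A: "A \<in> ?K" and B: "B \<in> ?K"
    \<comment> \<open>Used through A B - 1 = (A - 1) B + (B - 1).\<close>
    have "(A - mat 1) ** B \<in> int_multiples 3"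
      using int_multiples_mult[of "A - mat 1" 3 B 1] A B int by auto
    then have "(A - mat 1) ** B + (B - mat 1) \<in> int_multiples 3"
      using B by (intro int_multiples_add) auto
    then show "A \<otimes>\<^bsub>GL\<^esub> B \<in> ?K"
      using subgroup.m_closed[OF H] A B by (simp add: mult_GL matrix_diff_rdistrib)
  qed
  show ?thesis
  proof (rule finite_index_subgroupI[OF H K, where f = "\<lambda>A i j. \<lfloor>Re (A $ i $ j)\<rfloor> mod 3"])
    fix A B assume A: "A \<in> H" and B: "B \<in> H"
      and eq: "(\<lambda>i j. \<lfloor>Re (A $ i $ j)\<rfloor> mod 3) = (\<lambda>i j. \<lfloor>Re (B $ i $ j)\<rfloor> mod 3)"
    have "\<exists>z. (A - B) $ i $ j = of_int (3 * z)" for i j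
    proof -
      obtain a b where ab: "A $ i $ j = of_int a" "B $ i $ j = of_int b"
        using A B int by (metis int_multiples_1_iff Ints_cases subsetD)
      have "a mod 3 = b mod 3" using fun_cong[OF fun_cong[OF eq], of i j] ab by simp
      then obtain z where "a - b = 3 * z" by (metis mod_eq_dvd_iff dvdE)
      then have "(A - B) $ i $ j = of_int (3 * z)" using ab by (metis of_int_diff vector_minus_component)
      then show ?thesis by blast
    qed
    then have "A - B \<in> int_multiples 3" by (simp add: int_multiples_def)
    then show "A \<otimes>\<^bsub>GL\<^esub> inv\<^bsub>GL\<^esub> B \<in> ?K"
      using diff_in[OF A B] subgroup.m_closed[OF H A inv(3)[OF B]] by (simp add: mult_GL)
  qed (use finite_residues_mod_3 in auto)
qed

theorem theorem8:
  fixes G \<Gamma> :: "(complex^'n^'n) set"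
  assumes "linear_algebraic_over_Q G"
    and "arithmetic_subgroup G \<Gamma>"
  shows "\<exists>\<Gamma>'. finite_index_subgroup GL \<Gamma>' \<Gamma> \<and> torsion_free GL \<Gamma>'"
proof -
  interpret group "GL :: (complex^'n^'n) monoid" by (rule group_GL)
  have "subgroup (GL_over \<rat>) (GL :: (complex^'n^'n) monoid)"
    by (rule subgroup_GL_over) auto
  then have "subgroup (G \<inter> GL_over \<rat>) GL"
    using assms(1) by (auto simp: linear_algebraic_over_Q_def intro: subgroups_Inter_pair)
  then have \<Gamma>: "subgroup \<Gamma> GL"
    using assms(2) incl_subgroup by (auto simp: arithmetic_subgroup_def)
  \<comment> \<open>Commensurability makes the integral part \<open>H\<close> of finite index in
    \<Gamma>; on \<open>H\<close> reduction modulo 3 is available.\<close>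
  define H where "H = \<Gamma> \<inter> (G \<inter> GL_over \<int>)"
  have H\<Gamma>: "finite_index_subgroup GL H \<Gamma>"
    using assms(2) by (simp add: arithmetic_subgroup_def commensurable_def H_def)
  have H: "subgroup H GL"
    using H\<Gamma> incl_subgroup[OF \<Gamma>] by (simp add: finite_index_subgroup_def)
  let ?\<Gamma>' = "{A \<in> H. A - mat 1 \<in> int_multiples 3}"
  have "H \<subseteq> int_multiples 1"
    by (auto simp: H_def GL_over_def int_multiples_1_iff)
  then have "finite_index_subgroup GL ?\<Gamma>' \<Gamma>"
    using finite_index_subgroup_trans[OF \<Gamma> H\<Gamma>] mod_3_subgroup_finite_index[OF H] by blast
  moreover have "torsion_free GL ?\<Gamma>'"
    using GL_torsion_mod_3 subgroup.subset[OF H] by (auto simp: torsion_free_def one_GL)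
  ultimately show ?thesis by blast
qed

end
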